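(* For each positive integer $g$, $$\beta_g=\sum_{k=1}^{\lfloor (g-1)/2\rfloor}A_k\,4^{-k}.$$
   Context: All intervals are intervals of integers. A numerical set is a cofinite subset $S\subseteq\mathbb N=\{0,1,2,\dots\}$ containing $0$; for $S\ne\mathbb N$ its Frobenius number is $\max(\mathbb N-S)$. Its atom monoid is $A(S)=\{n\in\mathbb Z: n+S\subseteq S\}$. A small atom of a numerical set $S$ with Frobenius number $g$ is a nonzero element of $A(S)$ less than $g$. For $g\ge1$, $\mathcal S(g)$ is the set of numerical sets with Frobenius number $g$ ($|\mathcal S(g)|=2^{g-1}$), $\mathcal B(g)$ is the set of $S\in\mathcal S(g)$ having at least one small atom, and $\beta_g=|\mathcal B(g)|/2^{g-1}$. For $k\ge1$, an ordered pair $(L,M)$ of subsets of $(0,k)$ is admissible if $L\subseteq M$ and for every $x\in M$ there exists $y\in L$ with $x+y\le k$ and $x+y\notin M$; $A_k$ is the number of admissible ordered pairs of subsets of $(0,k)$. *)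

theory Defs
  imports Complex_Main
begin

definition numerical_set :: "nat set \<Rightarrow> bool" where
  "numerical_set S \<longleftrightarrow> 0 \<in> S \<and> finite (UNIV - S)"

text \<open>Only meaningful for a numerical set \<open>S \<noteq> UNIV\<close>.\<close>
definition frobenius_number :: "nat set \<Rightarrow> nat" where
  "frobenius_number S = Max (UNIV - S)"

definition atom_monoid :: "nat set \<Rightarrow> int set" where
  "atom_monoid S = {n. (\<lambda>s. n + s) ` (int ` S) \<subseteq> int ` S}"

definition small_atom :: "nat set \<Rightarrow> int \<Rightarrow> bool" where
  "small_atom S a \<longleftrightarrow> a \<in> atom_monoid S \<and> a \<noteq> 0 \<and> a < int (frobenius_number S)"

definition numerical_sets :: "nat \<Rightarrow> nat set set" where
  "numerical_sets g = {S. numerical_set S \<and> S \<noteq> UNIV \<and> frobenius_number S = g}"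

definition numerical_sets_small_atom :: "nat \<Rightarrow> nat set set" where
  "numerical_sets_small_atom g = {S \<in> numerical_sets g. \<exists>a. small_atom S a}"

definition beta :: "nat \<Rightarrow> real" where
  "beta g = real (card (numerical_sets_small_atom g)) / 2 ^ (g - 1)"

definition admissible :: "nat \<Rightarrow> nat set \<Rightarrow> nat set \<Rightarrow> bool" where
  "admissible k L M \<longleftrightarrow> L \<subseteq> {0<..<k} \<and> M \<subseteq> {0<..<k} \<and> L \<subseteq> M \<and>
     (\<forall>x\<in>M. \<exists>y\<in>L. x + y \<le> k \<and> x + y \<notin> M)"

definition num_admissible :: "nat \<Rightarrow> nat" where
  "num_admissible k = card {(L, M). admissible k L M}"

end

theory Submission
  imports Defs
begin

text \<open>
  Twice a small atom is again an atom and differs from \<open>g\<close>, so the largest small atom is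
  \<open>n = g - k\<close> for some \<open>k\<close> with \<open>0 < 2 * k < g\<close>.
  Put \<open>L = S \<inter> (0,k)\<close> and \<open>M = (S - n) \<inter> (0,k)\<close>.
  That \<open>n\<close> is an atom means \<open>n \<in> S\<close>, \<open>k \<notin> S\<close> and \<open>L \<subseteq> M\<close>; that no \<open>n + x\<close> with \<open>0 < x < k\<close>
  is one means that every \<open>x \<in> M\<close> has a \<open>y \<in> L\<close> with \<open>x + y \<le> k\<close> and \<open>x + y \<notin> M\<close>. The elements of
  \<open>S\<close> in \<open>(k,n)\<close> are unconstrained, which gives \<open>A\<^sub>k * 2 ^ (g - 1 - 2 * k)\<close> sets for each \<open>k\<close>.
\<close>

text \<open>Trades \<open>Max\<close> and cofiniteness for membership conditions: once everything
  above \<open>g\<close> lies in \<open>S\<close>, the complement sits inside \<open>{..g}\<close>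
  and is finite.\<close>

lemma numerical_sets_iff:
  "S \<in> numerical_sets g \<longleftrightarrow> 0 \<in> S \<and> g \<notin> S \<and> {g<..} \<subseteq> S"
proof
  assume "S \<in> numerical_sets g"
  then have S: "0 \<in> S" "finite (UNIV - S)" "UNIV - S \<noteq> {}" "Max (UNIV - S) = g"
    by (auto simp: numerical_sets_def numerical_set_def frobenius_number_def)
  from Max_in[OF S(2,3)] S(4) have "g \<notin> S" by auto
  moreover have "x \<in> S" if "g < x" for x
    using Max_ge[OF S(2), of x] S(4) that by auto
  ultimately show "0 \<in> S \<and> g \<notin> S \<and> {g<..} \<subseteq> S" using S(1) by auto
next
  assume S: "0 \<in> S \<and> g \<notin> S \<and> {g<..} \<subseteq> S"
  have sub: "UNIV - S \<subseteq> {..g}"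
    using S by (auto simp: not_less[symmetric])
  then have fin: "finite (UNIV - S)" by (rule finite_subset) simp
  have "Max (UNIV - S) = g"
    using S sub fin by (intro Max_eqI) auto
  then show "S \<in> numerical_sets g"
    using S fin by (auto simp: numerical_sets_def numerical_set_def frobenius_number_def)
qed

lemma small_atom_iff:
  assumes "S \<in> numerical_sets g"
  shows "small_atom S (int n) \<longleftrightarrow> 0 < n \<and> n < g \<and> (\<forall>s\<in>S. n + s \<in> S)"
proof -
  have "int n + int s \<in> int ` S \<longleftrightarrow> n + s \<in> S" for s
    by (simp add: inj_image_mem_iff flip: of_nat_add)
  then have "int n \<in> atom_monoid S \<longleftrightarrow> (\<forall>s\<in>S. n + s \<in> S)"
    by (simp add: atom_monoid_def image_subset_iff)
  moreover have "frobenius_number S = g"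
    using assms by (simp add: numerical_sets_def)
  ultimately show ?thesis by (auto simp: small_atom_def)
qed

text \<open>Since \<open>0\<close> is in \<open>S\<close>, an atom \<open>a = a + 0\<close> is
  itself an element of \<open>S\<close>. So atoms, although defined as integers, can be handled as
  naturals.\<close>

lemma small_atom_nonneg:
  assumes "S \<in> numerical_sets g" "small_atom S a"
  shows "0 \<le> a"
proof -
  have "a + int 0 \<in> int ` S"
    using assms unfolding numerical_sets_iff small_atom_def atom_monoid_def by blast
  then show ?thesis by auto
qed

text \<open>Letting \<open>m\<close> range over naturals loses nothing, because small atoms are
  nonnegative.\<close>

definition numerical_sets_largest_small_atom :: "nat \<Rightarrow> nat \<Rightarrow> nat set set" where
  "numerical_sets_largest_small_atom g n =
     {S \<in> numerical_sets g. small_atom S (int n) \<and> (\<forall>m. small_atom S (int m) \<longrightarrow> m \<le> n)}"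

lemma finite_numerical_sets: "finite (numerical_sets g)"
proof (rule finite_subset)
  show "numerical_sets g \<subseteq> (\<lambda>T. T \<union> {g<..}) ` Pow {..g}"
  proof
    fix S assume "S \<in> numerical_sets g"
    then have "S = (S \<inter> {..g}) \<union> {g<..}"
      by (auto simp: numerical_sets_iff)
    then show "S \<in> (\<lambda>T. T \<union> {g<..}) ` Pow {..g}" by blast
  qed
qed simp

lemma numerical_sets_small_atom_eq_UN:
  "numerical_sets_small_atom g =
     (\<Union>k\<in>{1..(g - 1) div 2}. numerical_sets_largest_small_atom g (g - k))"
proof (intro equalityI subsetI)
  fix S assume "S \<in> numerical_sets_small_atom g"
  then obtain a where S: "S \<in> numerical_sets g" and a: "small_atom S a"
    by (auto simp: numerical_sets_small_atom_def)
  have "small_atom S (int (nat a))" using a small_atom_nonneg[OF S a] by simp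
  moreover have bound: "\<forall>m. small_atom S (int m) \<longrightarrow> m \<le> g"
    using small_atom_iff[OF S] by auto
  ultimately obtain n where n: "small_atom S (int n)" "\<forall>m. small_atom S (int m) \<longrightarrow> m \<le> n"
    using Nat.ex_has_greatest_nat[of "\<lambda>m. small_atom S (int m)" "nat a" g] by auto
  note n' = n(1)[unfolded small_atom_iff[OF S]]
  have S': "0 \<in> S" "g \<notin> S" using S by (auto simp: numerical_sets_iff)
  have "n + (n + 0) \<in> S" using n' S' by blast
  then have "n + n \<noteq> g" using S' by auto
  moreover have "\<not> n + n < g"
  proof
    assume "n + n < g"
    moreover have "\<forall>s\<in>S. n + n + s \<in> S" using n' by (simp add: add.assoc)
    ultimately have "small_atom S (int (n + n))"
      unfolding small_atom_iff[OF S] using n' by simp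
    then show False using n(2) n' by fastforce
  qed
  \<comment> \<open>From \<open>n + n > g\<close>, the number \<open>k = g - n\<close> satisfies
    \<open>2 * k < g\<close>, that is \<open>2 * k \<le> g - 1\<close>; this is the upper limit of
    the sum.\<close>
  ultimately have "g - n \<in> {1..(g - 1) div 2}" "g - (g - n) = n" using n' by auto
  then show "S \<in> (\<Union>k\<in>{1..(g - 1) div 2}. numerical_sets_largest_small_atom g (g - k))"
    using S n unfolding numerical_sets_largest_small_atom_def by (intro UN_I) auto
qed (auto simp: numerical_sets_largest_small_atom_def numerical_sets_small_atom_def)

text \<open>Writing \<open>g = n + k\<close> avoids truncated subtraction; \<open>k < n\<close> then
  encodes \<open>2 * k < g\<close>.\<close>

lemma largest_small_atom_iff_admissible:
  assumes k: "0 < k" "k < n"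
  shows "S \<in> numerical_sets_largest_small_atom (n + k) n \<longleftrightarrow>
    S \<in> numerical_sets (n + k) \<and> k \<notin> S \<and> n \<in> S \<and>
    admissible k (S \<inter> {0<..<k}) {x \<in> {0<..<k}. n + x \<in> S}"
    (is "_ \<longleftrightarrow> ?R")
proof
  assume *: "S \<in> numerical_sets_largest_small_atom (n + k) n"
  then have S: "S \<in> numerical_sets (n + k)"
    and atom: "\<And>s. s \<in> S \<Longrightarrow> n + s \<in> S"
    and max: "\<And>m. small_atom S (int m) \<Longrightarrow> m \<le> n"
    by (auto simp: numerical_sets_largest_small_atom_def small_atom_iff)
  have S': "0 \<in> S" "n + k \<notin> S" "\<And>x. n + k < x \<Longrightarrow> x \<in> S"
    using S by (auto simp: numerical_sets_iff)
  have "\<exists>y\<in>S \<inter> {0<..<k}. x + y \<le> k \<and> x + y \<notin> {x \<in> {0<..<k}. n + x \<in> S}"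
    if x: "0 < x" "x < k" "n + x \<in> S" for x
  proof -
    have "\<not> small_atom S (int (n + x))" using max[of "n + x"] x by auto
    then obtain y where y: "y \<in> S" "n + x + y \<notin> S"
      using x unfolding small_atom_iff[OF S] by auto
    \<comment> \<open>The witness \<open>y\<close> is nonzero since \<open>n + x\<close> is in
      \<open>S\<close>, and \<open>x + y \<le> k\<close> since everything above \<open>n + k\<close>
      is in \<open>S\<close>.\<close>
    have "y \<noteq> 0" using y x by (cases y) auto
    moreover have "x + y \<le> k" using y S'(3)[of "n + x + y"] by force
    ultimately show ?thesis using x y by (intro bexI[of _ y]) (auto simp: add.assoc)
  qed
  then have "admissible k (S \<inter> {0<..<k}) {x \<in> {0<..<k}. n + x \<in> S}"
    unfolding admissible_def using atom by auto
  then show ?R using S S' atom[of 0] atom[of k] by auto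
next
  assume R: ?R
  then have S: "S \<in> numerical_sets (n + k)"
    and S': "0 \<in> S" "n + k \<notin> S" "\<And>x. n + k < x \<Longrightarrow> x \<in> S" "k \<notin> S" "n \<in> S"
    by (auto simp: numerical_sets_iff)
  have "S \<inter> {0<..<k} \<subseteq> {x \<in> {0<..<k}. n + x \<in> S}"
    using R by (simp add: admissible_def)
  then have LM: "n + x \<in> S" if "x \<in> S" "0 < x" "x < k" for x
    using that by auto
  have ex: "\<exists>y\<in>S. x + y \<le> k \<and> 0 < y \<and> \<not> (x + y < k \<and> n + (x + y) \<in> S)"
    if "0 < x" "x < k" "n + x \<in> S" for x
  proof -
    have "\<exists>y\<in>S \<inter> {0<..<k}. x + y \<le> k \<and> x + y \<notin> {x \<in> {0<..<k}. n + x \<in> S}"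
      using R that by (simp add: admissible_def)
    then show ?thesis by auto
  qed
  \<comment> \<open>Four cases: \<open>s = 0\<close> uses \<open>n \<in> S\<close>,
    \<open>0 < s < k\<close> uses \<open>L \<subseteq> M\<close>, \<open>s = k\<close> is excluded,
    and \<open>s > k\<close> lands beyond the Frobenius number.\<close>
  have "n + s \<in> S" if "s \<in> S" for s
    using that LM[of s] S' by (cases s k rule: linorder_cases; cases "s = 0") auto
  then have "small_atom S (int n)" unfolding small_atom_iff[OF S] using k by auto
  moreover have "m \<le> n" if m: "small_atom S (int m)" for m
  proof (rule ccontr)
    assume "\<not> m \<le> n"
    define x where "x = m - n"
    have mx: "m = n + x" "0 < x" using \<open>\<not> m \<le> n\<close> by (auto simp: x_def)
    have x: "x < k" "\<And>s. s \<in> S \<Longrightarrow> n + x + s \<in> S"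
      using m mx unfolding small_atom_iff[OF S] by auto
    \<comment> \<open>Adding the atom \<open>n + x\<close> to \<open>0\<close> puts \<open>x\<close>
      into \<open>M\<close>. Adding it to the resulting \<open>y\<close> leaves only
      \<open>x + y = k\<close>, which would put the Frobenius number into \<open>S\<close>.\<close>
    obtain y where y: "y \<in> S" "x + y \<le> k" "\<not> (x + y < k \<and> n + (x + y) \<in> S)"
      using ex[of x] x(1) x(2)[OF S'(1)] mx by auto
    have "n + (x + y) \<in> S" using x(2)[OF y(1)] by (simp add: add.assoc)
    with y have "x + y = k" by auto
    with \<open>n + (x + y) \<in> S\<close> S' show False by simp
  qed
  ultimately show "S \<in> numerical_sets_largest_small_atom (n + k) n"
    using S by (auto simp: numerical_sets_largest_small_atom_def)
qed

lemma card_numerical_sets_largest_small_atom: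
  assumes k: "0 < k" "k < n"
  shows "card (numerical_sets_largest_small_atom (n + k) n) = num_admissible k * 2 ^ (n - k - 1)"
proof -
  define f where "f = (\<lambda>S. ((S \<inter> {0<..<k}, {x \<in> {0<..<k}. n + x \<in> S}), S \<inter> {k<..<n}))"
  \<comment> \<open>The inverse of \<open>f\<close>: \<open>0\<close> and \<open>n\<close> are
    always present, \<open>k\<close> and \<open>n + k\<close> never, and \<open>L\<close>,
    \<open>F\<close> and the shifted \<open>M\<close> fill the three gaps between these
    points.\<close>
  define h where "h = (\<lambda>((L, M), F). {0, n} \<union> L \<union> F \<union> (+) n ` M \<union> {n + k<..})"
  let ?A = "numerical_sets_largest_small_atom (n + k) n"
  let ?B = "{(L, M). admissible k L M} \<times> Pow {k<..<n}"
  have hf: "h (f S) = S" if "S \<in> ?A" for S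
  proof -
    have S: "S \<in> numerical_sets (n + k)" "k \<notin> S" "n \<in> S"
      using that largest_small_atom_iff_admissible[OF k] by auto
    then have S': "0 \<in> S" "n + k \<notin> S" "\<And>x. n + k < x \<Longrightarrow> x \<in> S"
      by (auto simp: numerical_sets_iff)
    have "x \<in> h (f S)" if "x \<in> S" for x
    proof -
      have "x \<noteq> k" "x \<noteq> n + k" using that S S' by auto
      moreover have "x \<in> (+) n ` {x \<in> {0<..<k}. n + x \<in> S}" if "n < x" "x < n + k"
        using that \<open>x \<in> S\<close> by (intro image_eqI[of _ _ "x - n"]) auto
      ultimately show ?thesis
        using that by (cases x n rule: linorder_cases) (auto simp: h_def f_def)
    qed
    moreover have "h (f S) \<subseteq> S" using S S' by (auto simp: h_def f_def)
    ultimately show ?thesis by blast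
  qed
  have fh: "f (h p) = p" if p: "p \<in> ?B" for p
  proof -
    obtain L M F where [simp]: "p = ((L, M), F)" by (metis surj_pair)
    have "L \<subseteq> {0<..<k}" "M \<subseteq> {0<..<k}" "F \<subseteq> {k<..<n}"
      using p by (auto simp: admissible_def)
    then show ?thesis using k by (auto simp: f_def h_def)
  qed
  have fA: "f S \<in> ?B" if "S \<in> ?A" for S
    using that unfolding largest_small_atom_iff_admissible[OF k] by (auto simp: f_def)
  have hB: "h p \<in> ?A" if p: "p \<in> ?B" for p
  proof -
    obtain L M F where [simp]: "p = ((L, M), F)" by (metis surj_pair)
    have adm: "admissible k L M" and F: "F \<subseteq> {k<..<n}" using p by auto
    then have LM: "L \<subseteq> {0<..<k}" "M \<subseteq> {0<..<k}" by (auto simp: admissible_def)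
    have "h p \<in> numerical_sets (n + k)" "k \<notin> h p" "n \<in> h p"
      using LM F k by (auto simp: numerical_sets_iff h_def)
    moreover have "h p \<inter> {0<..<k} = L" "{x \<in> {0<..<k}. n + x \<in> h p} = M"
      using fh[OF p] by (simp_all add: f_def)
    ultimately show ?thesis using adm unfolding largest_small_atom_iff_admissible[OF k] by simp
  qed
  have "bij_betw f ?A ?B"
    by (intro bij_betw_byWitness[where f' = h] ballI image_subsetI hf fh fA hB)
  then have "card ?A = card ?B" by (rule bij_betw_same_card)
  then show ?thesis by (simp add: num_admissible_def card_cartesian_product card_Pow)
qed

theorem corollary6:
  fixes g :: nat
  assumes "g \<ge> 1"
  shows "beta g = (\<Sum>k = 1..(g - 1) div 2. real (num_admissible k) / 4 ^ k)"
proof -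
  let ?K = "{1..(g - 1) div 2}"
  let ?T = "\<lambda>k. numerical_sets_largest_small_atom g (g - k)"
  have fin: "finite (?T k)" for k
    using finite_numerical_sets[of g] by (simp add: numerical_sets_largest_small_atom_def)
  have disj: "?T i \<inter> ?T j = {}" if "i \<in> ?K" "j \<in> ?K" "i \<noteq> j" for i j
  proof -
    \<comment> \<open>Indices in the range are below \<open>g\<close>, so the subtraction does not
      truncate; a set has only one largest small atom.\<close>
    have "g - i \<noteq> g - j" using that by auto
    then show ?thesis
      unfolding numerical_sets_largest_small_atom_def by (auto dest: le_antisym)
  qed
  have "card (numerical_sets_small_atom g) = (\<Sum>k\<in>?K. card (?T k))"
    unfolding numerical_sets_small_atom_eq_UN
    by (rule card_UN_disjoint) (use fin disj in auto)
  then have "beta g = (\<Sum>k\<in>?K. real (card (?T k)) / 2 ^ (g - 1))"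
    by (simp add: beta_def sum_divide_distrib)
  also have "\<dots> = (\<Sum>k\<in>?K. real (num_admissible k) / 4 ^ k)"
  proof (rule sum.cong[OF refl])
    fix k assume "k \<in> ?K"
    \<comment> \<open>The middle block contributes \<open>2 ^ (g - 2 * k - 1)\<close>; dividing by
      \<open>2 ^ (g - 1)\<close> leaves \<open>4 ^ k\<close> in the denominator.\<close>
    then have k: "0 < k" "k < g - k" "g - k + k = g" and e: "g - 1 = (g - k - k - 1) + 2 * k"
      by auto
    have "(2::real) ^ (g - 1) = 2 ^ (g - k - k - 1) * 4 ^ k"
      by (subst e) (simp add: power_add power_mult)
    then show "real (card (?T k)) / 2 ^ (g - 1) = real (num_admissible k) / 4 ^ k"
      using card_numerical_sets_largest_small_atom[OF k(1,2)] k(3) by simp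
  qed
  finally show ?thesis .
qed

end
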